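(* Let $\mathcal{C}$ be a semi-abelian category and $G$ an object of $\mathcal{C}$. If $\{H_i\}_{i\in I}$ is a finite family of characteristic subobjects of $G$, then the intersection $\bigwedge_{i\in I} H_i$ is characteristic in $G$.
   Context: For an object $B$ of a pointed category $\mathcal{C}$ with finite limits and finite coproducts, let $\mathrm{Pt}_B(\mathcal{C})$ be the category of points over $B$: objects are split epimorphisms $(A,p,s)$ with $p\colon A\to B$, $s\colon B\to A$, $ps=1_B$; morphisms $(A,p,s)\to(A',p',s')$ are arrows $f\colon A\to A'$ with $p'f=p$, $fs=s'$. The functor $\mathrm{Ker}_B\colon \mathrm{Pt}_B(\mathcal{C})\to\mathcal{C}$, $(A,p,s)\mapsto \mathrm{Ker}(p)$, is right adjoint to $B+(-)$, which sends $X$ to the point $(B+X,[1,0],\iota_B)$. The induced monad on $\mathcal{C}$ is denoted $B\flat(-)$, so that $B\flat X$ is the kernel of $[1,0]\colon B+X\to B$. An (internal) action of $B$ on $X$ is an algebra $\xi\colon B\flat X\to X$ for this monad. A subobject $h\colon H\rightarrowtail G$ is called characteristic in $G$ if for every object $B$ and every action $\xi\colon B\flat G\to G$ there exists a (unique) action $\overline{\xi}\colon B\flat H\to H$ with $h\,\overline{\xi}=\xi\,(1_B\flat h)$. *)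

theory Defs
  imports Main
begin

section \<open>Categories, limits and colimits\<close>

record ('o, 'a) cat =
  Obj :: "'o set"
  Arr :: "'a set"
  Dom :: "'a \<Rightarrow> 'o"
  Cod :: "'a \<Rightarrow> 'o"
  Id :: "'o \<Rightarrow> 'a"
  Comp :: "'a \<Rightarrow> 'a \<Rightarrow> 'a"  (infixl "\<cdot>\<index>" 70)

definition Hom :: "('o, 'a) cat \<Rightarrow> 'o \<Rightarrow> 'o \<Rightarrow> 'a set" where
  "Hom C A B = {f \<in> Arr C. Dom C f = A \<and> Cod C f = B}"

text \<open>Composition is in the usual order: \<open>g \<cdot>\<^bsub>C\<^esub> f\<close> means first \<open>f\<close>, then \<open>g\<close>. Its value
  is only constrained on composable pairs of arrows.\<close>

locale category =
  fixes C :: "('o, 'a) cat" (structure)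
  assumes Dom_in_Obj: "f \<in> Arr C \<Longrightarrow> Dom C f \<in> Obj C"
    and Cod_in_Obj: "f \<in> Arr C \<Longrightarrow> Cod C f \<in> Obj C"
    and Id_in_Hom: "A \<in> Obj C \<Longrightarrow> Id C A \<in> Hom C A A"
    and Comp_in_Hom: "f \<in> Hom C A B \<Longrightarrow> g \<in> Hom C B D \<Longrightarrow> g \<cdot> f \<in> Hom C A D"
    and Comp_Id: "f \<in> Hom C A B \<Longrightarrow> f \<cdot> Id C A = f"
    and Id_Comp: "f \<in> Hom C A B \<Longrightarrow> Id C B \<cdot> f = f"
    and Comp_assoc:
      "f \<in> Hom C A B \<Longrightarrow> g \<in> Hom C B D \<Longrightarrow> k \<in> Hom C D E \<Longrightarrow> (k \<cdot> g) \<cdot> f = k \<cdot> (g \<cdot> f)"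

definition is_iso :: "('o, 'a) cat \<Rightarrow> 'a \<Rightarrow> bool" where
  "is_iso C f \<longleftrightarrow> f \<in> Arr C \<and>
     (\<exists>g \<in> Hom C (Cod C f) (Dom C f). g \<cdot>\<^bsub>C\<^esub> f = Id C (Dom C f) \<and> f \<cdot>\<^bsub>C\<^esub> g = Id C (Cod C f))"

definition is_mono :: "('o, 'a) cat \<Rightarrow> 'a \<Rightarrow> bool" where
  "is_mono C f \<longleftrightarrow> f \<in> Arr C \<and>
     (\<forall>T \<in> Obj C. \<forall>u \<in> Hom C T (Dom C f). \<forall>v \<in> Hom C T (Dom C f). f \<cdot>\<^bsub>C\<^esub> u = f \<cdot>\<^bsub>C\<^esub> v \<longrightarrow> u = v)"

definition is_functor ::
  "('j, 'u) cat \<Rightarrow> ('o, 'a) cat \<Rightarrow> ('j \<Rightarrow> 'o) \<Rightarrow> ('u \<Rightarrow> 'a) \<Rightarrow> bool" where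
  "is_functor J C Fo Fa \<longleftrightarrow> category J \<and> category C
     \<and> (\<forall>j \<in> Obj J. Fo j \<in> Obj C)
     \<and> (\<forall>u \<in> Arr J. Fa u \<in> Hom C (Fo (Dom J u)) (Fo (Cod J u)))
     \<and> (\<forall>j \<in> Obj J. Fa (Id J j) = Id C (Fo j))
     \<and> (\<forall>u \<in> Arr J. \<forall>v \<in> Arr J. Cod J u = Dom J v \<longrightarrow> Fa (v \<cdot>\<^bsub>J\<^esub> u) = Fa v \<cdot>\<^bsub>C\<^esub> Fa u)"

definition is_cone ::
  "('j, 'u) cat \<Rightarrow> ('o, 'a) cat \<Rightarrow> ('j \<Rightarrow> 'o) \<Rightarrow> ('u \<Rightarrow> 'a) \<Rightarrow> 'o \<Rightarrow> ('j \<Rightarrow> 'a) \<Rightarrow> bool" where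
  "is_cone J C Fo Fa L \<pi> \<longleftrightarrow> L \<in> Obj C
     \<and> (\<forall>j \<in> Obj J. \<pi> j \<in> Hom C L (Fo j))
     \<and> (\<forall>u \<in> Arr J. Fa u \<cdot>\<^bsub>C\<^esub> \<pi> (Dom J u) = \<pi> (Cod J u))"

definition is_limit ::
  "('j, 'u) cat \<Rightarrow> ('o, 'a) cat \<Rightarrow> ('j \<Rightarrow> 'o) \<Rightarrow> ('u \<Rightarrow> 'a) \<Rightarrow> 'o \<Rightarrow> ('j \<Rightarrow> 'a) \<Rightarrow> bool" where
  "is_limit J C Fo Fa L \<pi> \<longleftrightarrow> is_cone J C Fo Fa L \<pi>
     \<and> (\<forall>M \<sigma>. is_cone J C Fo Fa M \<sigma> \<longrightarrow>
          (\<exists>!t. t \<in> Hom C M L \<and> (\<forall>j \<in> Obj J. \<pi> j \<cdot>\<^bsub>C\<^esub> t = \<sigma> j)))"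

text \<open>Every finite category is isomorphic to one whose objects and arrows are natural numbers, so
  it is no restriction to take index categories of this type.\<close>

definition has_finite_limits :: "('o, 'a) cat \<Rightarrow> bool" where
  "has_finite_limits C \<longleftrightarrow>
     (\<forall>(J :: (nat, nat) cat) Fo Fa. finite (Obj J) \<longrightarrow> finite (Arr J) \<longrightarrow> is_functor J C Fo Fa \<longrightarrow>
        (\<exists>L \<pi>. is_limit J C Fo Fa L \<pi>))"

text \<open>\<open>is_pullback C f g p q\<close>: the square \<open>f \<cdot> p = g \<cdot> q\<close> is a pullback.\<close>

definition is_pullback :: "('o, 'a) cat \<Rightarrow> 'a \<Rightarrow> 'a \<Rightarrow> 'a \<Rightarrow> 'a \<Rightarrow> bool" where
  "is_pullback C f g p q \<longleftrightarrow>
     f \<in> Arr C \<and> g \<in> Arr C \<and> p \<in> Arr C \<and> q \<in> Arr C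
     \<and> Cod C f = Cod C g \<and> Dom C p = Dom C q \<and> Cod C p = Dom C f \<and> Cod C q = Dom C g
     \<and> f \<cdot>\<^bsub>C\<^esub> p = g \<cdot>\<^bsub>C\<^esub> q
     \<and> (\<forall>T \<in> Obj C. \<forall>u \<in> Hom C T (Dom C f). \<forall>v \<in> Hom C T (Dom C g).
          f \<cdot>\<^bsub>C\<^esub> u = g \<cdot>\<^bsub>C\<^esub> v \<longrightarrow>
          (\<exists>!t. t \<in> Hom C T (Dom C p) \<and> p \<cdot>\<^bsub>C\<^esub> t = u \<and> q \<cdot>\<^bsub>C\<^esub> t = v))"

definition is_coequalizer :: "('o, 'a) cat \<Rightarrow> 'a \<Rightarrow> 'a \<Rightarrow> 'a \<Rightarrow> bool" where
  "is_coequalizer C f g q \<longleftrightarrow>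
     f \<in> Arr C \<and> g \<in> Arr C \<and> q \<in> Arr C
     \<and> Dom C f = Dom C g \<and> Cod C f = Cod C g \<and> Dom C q = Cod C f
     \<and> q \<cdot>\<^bsub>C\<^esub> f = q \<cdot>\<^bsub>C\<^esub> g
     \<and> (\<forall>T \<in> Obj C. \<forall>u \<in> Hom C (Cod C f) T. u \<cdot>\<^bsub>C\<^esub> f = u \<cdot>\<^bsub>C\<^esub> g \<longrightarrow>
          (\<exists>!t. t \<in> Hom C (Cod C q) T \<and> t \<cdot>\<^bsub>C\<^esub> q = u))"

definition is_regular_epi :: "('o, 'a) cat \<Rightarrow> 'a \<Rightarrow> bool" where
  "is_regular_epi C q \<longleftrightarrow> (\<exists>f g. is_coequalizer C f g q)"

definition is_coproduct :: "('o, 'a) cat \<Rightarrow> 'o \<Rightarrow> 'o \<Rightarrow> 'a \<Rightarrow> 'a \<Rightarrow> bool" where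
  "is_coproduct C A B i j \<longleftrightarrow>
     i \<in> Hom C A (Cod C i) \<and> j \<in> Hom C B (Cod C i)
     \<and> (\<forall>T \<in> Obj C. \<forall>f \<in> Hom C A T. \<forall>g \<in> Hom C B T.
          (\<exists>!t. t \<in> Hom C (Cod C i) T \<and> t \<cdot>\<^bsub>C\<^esub> i = f \<and> t \<cdot>\<^bsub>C\<^esub> j = g))"

definition has_binary_coproducts :: "('o, 'a) cat \<Rightarrow> bool" where
  "has_binary_coproducts C \<longleftrightarrow> (\<forall>A \<in> Obj C. \<forall>B \<in> Obj C. \<exists>i j. is_coproduct C A B i j)"

definition is_zero_object :: "('o, 'a) cat \<Rightarrow> 'o \<Rightarrow> bool" where
  "is_zero_object C Z \<longleftrightarrow> Z \<in> Obj C
     \<and> (\<forall>A \<in> Obj C. (\<exists>!f. f \<in> Hom C A Z) \<and> (\<exists>!f. f \<in> Hom C Z A))"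

definition is_pointed :: "('o, 'a) cat \<Rightarrow> bool" where
  "is_pointed C \<longleftrightarrow> (\<exists>Z. is_zero_object C Z)"

definition zero_arrow :: "('o, 'a) cat \<Rightarrow> 'o \<Rightarrow> 'o \<Rightarrow> 'a" where
  "zero_arrow C A B =
     (THE f. \<exists>Z u v. is_zero_object C Z \<and> u \<in> Hom C A Z \<and> v \<in> Hom C Z B \<and> f = v \<cdot>\<^bsub>C\<^esub> u)"

definition is_kernel :: "('o, 'a) cat \<Rightarrow> 'a \<Rightarrow> 'a \<Rightarrow> bool" where
  "is_kernel C f k \<longleftrightarrow>
     f \<in> Arr C \<and> k \<in> Arr C \<and> Cod C k = Dom C f
     \<and> f \<cdot>\<^bsub>C\<^esub> k = zero_arrow C (Dom C k) (Cod C f)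
     \<and> (\<forall>T \<in> Obj C. \<forall>u \<in> Hom C T (Dom C f). f \<cdot>\<^bsub>C\<^esub> u = zero_arrow C T (Cod C f) \<longrightarrow>
          (\<exists>!t. t \<in> Hom C T (Dom C k) \<and> k \<cdot>\<^bsub>C\<^esub> t = u))"

section \<open>Points and semi-abelian categories\<close>

text \<open>Objects \<open>(A, p, s)\<close> and morphisms of the category of points over \<open>B\<close>.\<close>

definition is_point :: "('o, 'a) cat \<Rightarrow> 'o \<Rightarrow> 'o \<times> 'a \<times> 'a \<Rightarrow> bool" where
  "is_point C B = (\<lambda>(A, p, s). p \<in> Hom C A B \<and> s \<in> Hom C B A \<and> p \<cdot>\<^bsub>C\<^esub> s = Id C B)"

definition Pt_Hom :: "('o, 'a) cat \<Rightarrow> 'o \<times> 'a \<times> 'a \<Rightarrow> 'o \<times> 'a \<times> 'a \<Rightarrow> 'a set" where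
  "Pt_Hom C = (\<lambda>(A, p, s) (A', p', s'). {f \<in> Hom C A A'. p' \<cdot>\<^bsub>C\<^esub> f = p \<and> f \<cdot>\<^bsub>C\<^esub> s = s'})"

text \<open>Regular: finite limits, coequalizers of kernel pairs, pullback-stable regular epimorphisms.\<close>

definition is_regular :: "('o, 'a) cat \<Rightarrow> bool" where
  "is_regular C \<longleftrightarrow> category C \<and> has_finite_limits C
     \<and> (\<forall>f r s. is_pullback C f f r s \<longrightarrow> (\<exists>q. is_coequalizer C r s q))
     \<and> (\<forall>f g p q. is_pullback C f g p q \<longrightarrow> is_regular_epi C f \<longrightarrow> is_regular_epi C q)"

text \<open>Internal equivalence relations \<open>(r, s) : R \<rightarrow> A\<close>. Transitivity refers to the pullback of \<open>s\<close>
  and \<open>r\<close>, the object of composable pairs.\<close>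

definition is_equivalence_relation :: "('o, 'a) cat \<Rightarrow> 'o \<Rightarrow> 'a \<Rightarrow> 'a \<Rightarrow> bool" where
  "is_equivalence_relation C A r s \<longleftrightarrow>
     r \<in> Hom C (Dom C r) A \<and> s \<in> Hom C (Dom C r) A
     \<and> (\<forall>T \<in> Obj C. \<forall>u \<in> Hom C T (Dom C r). \<forall>v \<in> Hom C T (Dom C r).
          r \<cdot>\<^bsub>C\<^esub> u = r \<cdot>\<^bsub>C\<^esub> v \<longrightarrow> s \<cdot>\<^bsub>C\<^esub> u = s \<cdot>\<^bsub>C\<^esub> v \<longrightarrow> u = v)
     \<and> (\<exists>e \<in> Hom C A (Dom C r). r \<cdot>\<^bsub>C\<^esub> e = Id C A \<and> s \<cdot>\<^bsub>C\<^esub> e = Id C A)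
     \<and> (\<exists>t \<in> Hom C (Dom C r) (Dom C r). r \<cdot>\<^bsub>C\<^esub> t = s \<and> s \<cdot>\<^bsub>C\<^esub> t = r)
     \<and> (\<forall>p q. is_pullback C s r p q \<longrightarrow>
          (\<exists>m \<in> Hom C (Dom C p) (Dom C r). r \<cdot>\<^bsub>C\<^esub> m = r \<cdot>\<^bsub>C\<^esub> p \<and> s \<cdot>\<^bsub>C\<^esub> m = s \<cdot>\<^bsub>C\<^esub> q))"

definition is_barr_exact :: "('o, 'a) cat \<Rightarrow> bool" where
  "is_barr_exact C \<longleftrightarrow> is_regular C
     \<and> (\<forall>A r s. is_equivalence_relation C A r s \<longrightarrow> (\<exists>f. is_pullback C f f r s))"

text \<open>Bourn's definition: for every \<open>v : E \<rightarrow> B\<close> the change-of-base functor from points over \<open>B\<close> to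
  points over \<open>E\<close> reflects isomorphisms. Here \<open>g\<close> is the image of \<open>f\<close> under this functor, computed
  with arbitrary pullbacks of \<open>p\<close> and \<open>p'\<close> along \<open>v\<close>. An isomorphism of points is the same as a
  morphism of points that is invertible in \<open>C\<close>.\<close>

definition is_protomodular :: "('o, 'a) cat \<Rightarrow> bool" where
  "is_protomodular C \<longleftrightarrow> category C \<and> has_finite_limits C
     \<and> (\<forall>E B v A p s A' p' s' f a q a' q' g.
          v \<in> Hom C E B \<longrightarrow> is_point C B (A, p, s) \<longrightarrow> is_point C B (A', p', s') \<longrightarrow>
          f \<in> Pt_Hom C (A, p, s) (A', p', s') \<longrightarrow>
          is_pullback C p v a q \<longrightarrow> is_pullback C p' v a' q' \<longrightarrow>
          g \<in> Hom C (Dom C a) (Dom C a') \<longrightarrow> a' \<cdot>\<^bsub>C\<^esub> g = f \<cdot>\<^bsub>C\<^esub> a \<longrightarrow> q' \<cdot>\<^bsub>C\<^esub> g = q \<longrightarrow>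
          is_iso C g \<longrightarrow> is_iso C f)"

definition semi_abelian :: "('o, 'a) cat \<Rightarrow> bool" where
  "semi_abelian C \<longleftrightarrow> category C \<and> is_pointed C \<and> is_barr_exact C \<and> is_protomodular C
     \<and> has_binary_coproducts C"

section \<open>The monad of internal actions\<close>

text \<open>A choice of coproducts and kernels is fixed by Hilbert choice; nothing is known about it
  beyond the universal properties.\<close>

definition coprod_inj :: "('o, 'a) cat \<Rightarrow> 'o \<Rightarrow> 'o \<Rightarrow> 'a \<times> 'a" where
  "coprod_inj C A B = (SOME (i, j). is_coproduct C A B i j)"

definition inl :: "('o, 'a) cat \<Rightarrow> 'o \<Rightarrow> 'o \<Rightarrow> 'a" where
  "inl C A B = fst (coprod_inj C A B)"

definition inr :: "('o, 'a) cat \<Rightarrow> 'o \<Rightarrow> 'o \<Rightarrow> 'a" where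
  "inr C A B = snd (coprod_inj C A B)"

definition coprod :: "('o, 'a) cat \<Rightarrow> 'o \<Rightarrow> 'o \<Rightarrow> 'o" where
  "coprod C A B = Cod C (inl C A B)"

definition copair :: "('o, 'a) cat \<Rightarrow> 'a \<Rightarrow> 'a \<Rightarrow> 'a" where
  "copair C f g =
     (THE t. t \<in> Hom C (coprod C (Dom C f) (Dom C g)) (Cod C f)
        \<and> t \<cdot>\<^bsub>C\<^esub> inl C (Dom C f) (Dom C g) = f \<and> t \<cdot>\<^bsub>C\<^esub> inr C (Dom C f) (Dom C g) = g)"

definition ker :: "('o, 'a) cat \<Rightarrow> 'a \<Rightarrow> 'a" where
  "ker C p = (SOME k. is_kernel C p k)"

text \<open>The functor from points over \<open>B\<close> to \<open>C\<close> that takes kernels.\<close>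

definition Ker_obj :: "('o, 'a) cat \<Rightarrow> 'o \<times> 'a \<times> 'a \<Rightarrow> 'o" where
  "Ker_obj C = (\<lambda>(A, p, s). Dom C (ker C p))"

definition Ker_map :: "('o, 'a) cat \<Rightarrow> 'o \<times> 'a \<times> 'a \<Rightarrow> 'o \<times> 'a \<times> 'a \<Rightarrow> 'a \<Rightarrow> 'a" where
  "Ker_map C = (\<lambda>(A, p, s) (A', p', s') f.
     THE t. t \<in> Hom C (Ker_obj C (A, p, s)) (Ker_obj C (A', p', s'))
       \<and> ker C p' \<cdot>\<^bsub>C\<^esub> t = f \<cdot>\<^bsub>C\<^esub> ker C p)"

text \<open>Its left adjoint \<open>X \<mapsto> (B + X, [1, 0], \<iota>\<^sub>B)\<close>.\<close>

definition free_point :: "('o, 'a) cat \<Rightarrow> 'o \<Rightarrow> 'o \<Rightarrow> 'o \<times> 'a \<times> 'a" where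
  "free_point C B X = (coprod C B X, copair C (Id C B) (zero_arrow C X B), inl C B X)"

definition free_point_map :: "('o, 'a) cat \<Rightarrow> 'o \<Rightarrow> 'a \<Rightarrow> 'a" where
  "free_point_map C B f = copair C (inl C B (Cod C f)) (inr C B (Cod C f) \<cdot>\<^bsub>C\<^esub> f)"

text \<open>The counit \<open>[s, ker p] : B + Ker(p) \<rightarrow> A\<close> of the adjunction at the point \<open>(A, p, s)\<close>; the
  unit at \<open>X\<close> is \<open>flat_unit\<close> below.\<close>

definition point_counit :: "('o, 'a) cat \<Rightarrow> 'o \<times> 'a \<times> 'a \<Rightarrow> 'a" where
  "point_counit C = (\<lambda>(A, p, s). copair C s (ker C p))"

text \<open>The induced monad: the composite functor, the unit of the adjunction, and \<open>Ker\<close> applied to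
  the counit at free points.\<close>

definition flat :: "('o, 'a) cat \<Rightarrow> 'o \<Rightarrow> 'o \<Rightarrow> 'o" where
  "flat C B X = Ker_obj C (free_point C B X)"

definition flat_map :: "('o, 'a) cat \<Rightarrow> 'o \<Rightarrow> 'a \<Rightarrow> 'a" where
  "flat_map C B f =
     Ker_map C (free_point C B (Dom C f)) (free_point C B (Cod C f)) (free_point_map C B f)"

definition flat_unit :: "('o, 'a) cat \<Rightarrow> 'o \<Rightarrow> 'o \<Rightarrow> 'a" where
  "flat_unit C B X =
     (THE t. t \<in> Hom C X (flat C B X)
        \<and> ker C (copair C (Id C B) (zero_arrow C X B)) \<cdot>\<^bsub>C\<^esub> t = inr C B X)"

definition flat_mult :: "('o, 'a) cat \<Rightarrow> 'o \<Rightarrow> 'o \<Rightarrow> 'a" where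
  "flat_mult C B X =
     Ker_map C (free_point C B (flat C B X)) (free_point C B X) (point_counit C (free_point C B X))"

definition is_action :: "('o, 'a) cat \<Rightarrow> 'o \<Rightarrow> 'o \<Rightarrow> 'a \<Rightarrow> bool" where
  "is_action C B X \<xi> \<longleftrightarrow> \<xi> \<in> Hom C (flat C B X) X
     \<and> \<xi> \<cdot>\<^bsub>C\<^esub> flat_unit C B X = Id C X
     \<and> \<xi> \<cdot>\<^bsub>C\<^esub> flat_mult C B X = \<xi> \<cdot>\<^bsub>C\<^esub> flat_map C B \<xi>"

section \<open>Subobjects\<close>

text \<open>Subobjects are given by representing monomorphisms, preordered by factorization.\<close>

definition is_subobject :: "('o, 'a) cat \<Rightarrow> 'o \<Rightarrow> 'a \<Rightarrow> bool" where
  "is_subobject C G h \<longleftrightarrow> is_mono C h \<and> Cod C h = G"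

definition sub_le :: "('o, 'a) cat \<Rightarrow> 'a \<Rightarrow> 'a \<Rightarrow> bool" where
  "sub_le C m n \<longleftrightarrow> (\<exists>t \<in> Hom C (Dom C m) (Dom C n). m = n \<cdot>\<^bsub>C\<^esub> t)"

definition characteristic :: "('o, 'a) cat \<Rightarrow> 'o \<Rightarrow> 'a \<Rightarrow> bool" where
  "characteristic C G h \<longleftrightarrow> is_subobject C G h
     \<and> (\<forall>B \<in> Obj C. \<forall>\<xi>. is_action C B G \<xi> \<longrightarrow>
          (\<exists>!\<xi>'. is_action C B (Dom C h) \<xi>' \<and> h \<cdot>\<^bsub>C\<^esub> \<xi>' = \<xi> \<cdot>\<^bsub>C\<^esub> flat_map C B h))"

text \<open>\<open>m\<close> represents the meet of the family \<open>h\<close> in the poset of subobjects of \<open>G\<close>. For empty \<open>I\<close>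
  this is the largest subobject, \<open>G\<close> itself.\<close>

definition is_intersection ::
  "('o, 'a) cat \<Rightarrow> 'o \<Rightarrow> 'i set \<Rightarrow> ('i \<Rightarrow> 'a) \<Rightarrow> 'a \<Rightarrow> bool" where
  "is_intersection C G I h m \<longleftrightarrow> is_subobject C G m
     \<and> (\<forall>i \<in> I. sub_le C m (h i))
     \<and> (\<forall>n. is_subobject C G n \<longrightarrow> (\<forall>i \<in> I. sub_le C n (h i)) \<longrightarrow> sub_le C n m)"

end

theory Submission
  imports Defs
begin

text \<open>A finite meet of subobjects is an iterated pullback, so an arbitrary arrow into \<open>G\<close> that
  factors through every \<open>h i\<close> factors through the meet \<open>m\<close>. For an action \<open>\<xi>\<close> of \<open>B\<close> on \<open>G\<close> this
  applies to \<open>\<xi> \<cdot> (B \<flat> m)\<close>, which factors through \<open>h i\<close> because \<open>\<xi>\<close> restricts to \<open>h i\<close>. The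
  resulting arrow satisfies the algebra laws because \<open>m\<close> is a monomorphism.\<close>

section \<open>Pullbacks and finite meets\<close>

lemma Hom_Dom_Cod: "f \<in> Hom C A B \<Longrightarrow> f \<in> Arr C \<and> Dom C f = A \<and> Cod C f = B"
  by (simp add: Hom_def)

lemma (in category) Hom_Obj: "f \<in> Hom C A B \<Longrightarrow> A \<in> Obj C \<and> B \<in> Obj C"
  using Dom_in_Obj Cod_in_Obj by (auto simp: Hom_def)

text \<open>The index category \<open>0 \<rightarrow> 2 \<leftarrow> 1\<close>: arrows
  \<open>0\<close>, \<open>1\<close>, \<open>2\<close> are the identities, \<open>3\<close> and
  \<open>4\<close> the two legs. The only arrow leaving \<open>2\<close> is its identity, so in a
  composable pair either \<open>u\<close> is a leg and \<open>v\<close> is the identity of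
  \<open>2\<close>, or \<open>u\<close> is an identity; this justifies \<open>Comp\<close>.\<close>

definition cospan_shape :: "(nat, nat) cat" where
  "cospan_shape = \<lparr>Obj = {0, 1, 2}, Arr = {0, 1, 2, 3, 4},
     Dom = (\<lambda>u. if u = 3 then 0 else if u = 4 then 1 else u),
     Cod = (\<lambda>u. if u = 3 \<or> u = 4 then 2 else u),
     Id = (\<lambda>j. j), Comp = (\<lambda>v u. if u = 3 \<or> u = 4 then u else v)\<rparr>"

lemma cospan_shape_simps:
  "Obj cospan_shape = {0, 1, 2}" "Arr cospan_shape = {0, 1, 2, 3, 4}"
  "Dom cospan_shape u = (if u = 3 then 0 else if u = 4 then 1 else u)"
  "Cod cospan_shape u = (if u = 3 \<or> u = 4 then 2 else u)"
  "Id cospan_shape j = j"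
  "Comp cospan_shape v u = (if u = 3 \<or> u = 4 then u else v)"
  by (simp_all add: cospan_shape_def)

lemma category_cospan_shape: "category cospan_shape"
  by unfold_locales (auto simp: cospan_shape_simps Hom_def split: if_splits)

text \<open>A limit over the cospan shape has three legs; the one at index \<open>2\<close> is
  determined by either of the others, and forgetting it leaves a pullback.\<close>

lemma (in category) pullback_exists:
  assumes lim: "has_finite_limits C" and f: "f \<in> Hom C A D" and g: "g \<in> Hom C B D"
  shows "\<exists>p q. is_pullback C f g p q"
proof -
  define Fo where "Fo j = (if j = 0 then A else if j = 1 then B else D)" for j :: nat
  define Fa where "Fa u = (if u = 3 then f else if u = 4 then g else Id C (Fo u))" for u :: nat
  note ob = Hom_Obj[OF f] Hom_Obj[OF g]
  have "is_functor cospan_shape C Fo Fa"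
    unfolding is_functor_def using ob f g Id_in_Hom
    by (auto simp: category_cospan_shape category_axioms cospan_shape_simps Fo_def Fa_def
        Comp_Id[OF f] Comp_Id[OF g] Id_Comp[OF f] Id_Comp[OF g] Comp_Id[OF Id_in_Hom])
  then obtain L \<pi> where L: "is_limit cospan_shape C Fo Fa L \<pi>"
    using lim unfolding has_finite_limits_def by (metis finite.emptyI finite.insertI cospan_shape_simps(1,2))
  then have cone: "is_cone cospan_shape C Fo Fa L \<pi>"
    by (simp add: is_limit_def)
  then have p: "\<pi> 0 \<in> Hom C L A" "\<pi> 1 \<in> Hom C L B"
    and sq: "f \<cdot> \<pi> 0 = \<pi> 2" "g \<cdot> \<pi> 1 = \<pi> 2"
    by (auto simp: is_cone_def cospan_shape_simps Fo_def Fa_def)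
  have univ: "\<exists>!t. t \<in> Hom C T L \<and> \<pi> 0 \<cdot> t = u \<and> \<pi> 1 \<cdot> t = v"
    if u: "u \<in> Hom C T A" and v: "v \<in> Hom C T B" and uv: "f \<cdot> u = g \<cdot> v" for T u v
  proof -
    \<comment> \<open>The leg at \<open>2\<close> is forced to be \<open>f \<cdot> u\<close>, equal
      to \<open>g \<cdot> v\<close> by \<open>uv\<close>.\<close>
    define \<sigma> where "\<sigma> j = (if j = 0 then u else if j = 1 then v else f \<cdot> u)" for j :: nat
    have "is_cone cospan_shape C Fo Fa T \<sigma>"
      using u v uv Hom_Obj[OF u] Comp_in_Hom[OF u f]
      by (auto simp: is_cone_def cospan_shape_simps Fo_def Fa_def \<sigma>_def
          Id_Comp[OF u] Id_Comp[OF v] Id_Comp[OF Comp_in_Hom[OF u f]]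
          Id_Comp[OF Comp_in_Hom[OF v g]])
    with L have "\<exists>!t. t \<in> Hom C T L \<and> (\<forall>j \<in> Obj cospan_shape. \<pi> j \<cdot> t = \<sigma> j)"
      by (simp add: is_limit_def)
    \<comment> \<open>The condition at \<open>2\<close> follows from the one at \<open>0\<close> by
      composing with \<open>f\<close>.\<close>
    moreover have "(\<forall>j \<in> Obj cospan_shape. \<pi> j \<cdot> t = \<sigma> j) \<longleftrightarrow> \<pi> 0 \<cdot> t = u \<and> \<pi> 1 \<cdot> t = v"
      if t: "t \<in> Hom C T L" for t
      using Comp_assoc[OF t p(1) f] sq by (auto simp: cospan_shape_simps \<sigma>_def)
    ultimately show ?thesis
      by (smt (verit))
  qed
  have "is_pullback C f g (\<pi> 0) (\<pi> 1)"
    using Hom_Dom_Cod[OF f] Hom_Dom_Cod[OF g] Hom_Dom_Cod[OF p(1)] Hom_Dom_Cod[OF p(2)] sq univ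
    by (simp add: is_pullback_def)
  then show ?thesis
    by blast
qed

lemma (in category) pullback_factor:
  assumes "is_pullback C f g p q" and u: "u \<in> Hom C T (Dom C f)" and "v \<in> Hom C T (Dom C g)"
    and "f \<cdot> u = g \<cdot> v"
  shows "\<exists>!t. t \<in> Hom C T (Dom C p) \<and> p \<cdot> t = u \<and> q \<cdot> t = v"
  using assms Hom_Obj[OF u] unfolding is_pullback_def by blast

text \<open>Induction on the family, adding one subobject at a time by a pullback. Factorization is
  claimed for every arrow \<open>k\<close> into \<open>G\<close>, whereas
  \<open>is_intersection\<close> tests only monomorphisms: the arrow to be factored later, an action
  composed with \<open>flat_map\<close>, need not be monic.\<close>

lemma (in category) finite_meet_arrow:
  assumes lim: "has_finite_limits C" and G: "G \<in> Obj C" and fin: "finite I"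
    and sub: "\<forall>i \<in> I. is_subobject C G (h i)"
  shows "\<exists>n. is_subobject C G n \<and> (\<forall>i \<in> I. sub_le C n (h i)) \<and>
    (\<forall>T. \<forall>k \<in> Hom C T G. (\<forall>i \<in> I. \<exists>s \<in> Hom C T (Dom C (h i)). k = h i \<cdot> s) \<longrightarrow>
       (\<exists>s \<in> Hom C T (Dom C n). k = n \<cdot> s))"
  using fin sub
proof (induction I)
  case empty
  \<comment> \<open>The empty meet is all of \<open>G\<close>, represented by the identity.\<close>
  have "is_subobject C G (Id C G)"
    using Hom_Dom_Cod[OF Id_in_Hom[OF G]] by (auto simp: is_subobject_def is_mono_def Id_Comp)
  moreover have "\<exists>s \<in> Hom C T (Dom C (Id C G)). k = Id C G \<cdot> s" if "k \<in> Hom C T G" for T k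
    using that Hom_Dom_Cod[OF Id_in_Hom[OF G]] Id_Comp[OF that] by (intro bexI[of _ k]) simp_all
  ultimately show ?case
    by blast
next
  case (insert x F)
  then obtain n where n: "is_subobject C G n" "\<forall>i \<in> F. sub_le C n (h i)"
    and univ: "\<And>T k. k \<in> Hom C T G \<Longrightarrow> \<forall>i \<in> F. \<exists>s \<in> Hom C T (Dom C (h i)). k = h i \<cdot> s \<Longrightarrow>
       \<exists>s \<in> Hom C T (Dom C n). k = n \<cdot> s"
    by (metis insertCI)
  have hx: "is_subobject C G (h x)"
    using insert.prems by simp
  define A where "A = Dom C (h x)"
  define N where "N = Dom C n"
  have hH: "h x \<in> Hom C A G" and nH: "n \<in> Hom C N G"
    using hx n(1) by (auto simp: is_subobject_def is_mono_def Hom_def A_def N_def)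
  \<comment> \<open>The new meet is the diagonal \<open>n \<cdot> q\<close> of the pullback of
    \<open>h x\<close> and \<open>n\<close>.\<close>
  obtain p q where pb: "is_pullback C (h x) n p q"
    using pullback_exists[OF lim hH nH] by blast
  define P where "P = Dom C p"
  have pH: "p \<in> Hom C P A" and qH: "q \<in> Hom C P N" and sq: "h x \<cdot> p = n \<cdot> q"
    using pb by (auto simp: is_pullback_def Hom_def P_def A_def N_def)
  have pbu: "\<exists>!t. t \<in> Hom C T P \<and> p \<cdot> t = u \<and> q \<cdot> t = v"
    if "u \<in> Hom C T A" "v \<in> Hom C T N" "h x \<cdot> u = n \<cdot> v" for T u v
    using pullback_factor[OF pb] that unfolding A_def N_def P_def .
  have mH: "n \<cdot> q \<in> Hom C P G"
    using Comp_in_Hom[OF qH nH] .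
  then have mD: "Dom C (n \<cdot> q) = P"
    by (simp add: Hom_def)
  \<comment> \<open>The diagonal is monic: cancelling \<open>n\<close> gives equal
    \<open>q\<close>-components, and cancelling \<open>h x\<close> in the other expression of the
    diagonal gives equal \<open>p\<close>-components; uniqueness in the pullback then identifies
    \<open>u\<close> and \<open>v\<close>.\<close>
  have "u = v" if u: "u \<in> Hom C T P" and v: "v \<in> Hom C T P" and e: "n \<cdot> q \<cdot> u = n \<cdot> q \<cdot> v" for T u v
  proof -
    have T: "T \<in> Obj C"
      using Hom_Obj[OF u] by blast
    have "n \<cdot> (q \<cdot> u) = n \<cdot> (q \<cdot> v)"
      using e Comp_assoc[OF u qH nH] Comp_assoc[OF v qH nH] by simp
    then have q: "q \<cdot> u = q \<cdot> v"
      using n(1) T Comp_in_Hom[OF u qH] Comp_in_Hom[OF v qH]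
      unfolding is_subobject_def is_mono_def N_def by blast
    have "h x \<cdot> (p \<cdot> u) = h x \<cdot> (p \<cdot> v)"
      using e sq Comp_assoc[OF u pH hH] Comp_assoc[OF v pH hH] by simp
    then have p: "p \<cdot> u = p \<cdot> v"
      using hx T Comp_in_Hom[OF u pH] Comp_in_Hom[OF v pH]
      unfolding is_subobject_def is_mono_def A_def by blast
    have "h x \<cdot> (p \<cdot> v) = n \<cdot> (q \<cdot> v)"
      using sq Comp_assoc[OF v pH hH] Comp_assoc[OF v qH nH] by simp
    then show ?thesis
      using pbu[OF Comp_in_Hom[OF v pH] Comp_in_Hom[OF v qH]] u v p q by blast
  qed
  then have "is_subobject C G (n \<cdot> q)"
    using mH by (auto simp: is_subobject_def is_mono_def Hom_def)
  moreover have "sub_le C (n \<cdot> q) (h i)" if i: "i \<in> insert x F" for i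
  proof (cases "i = x")
    case True
    then show ?thesis
      using pH sq mD unfolding sub_le_def A_def by metis
  next
    case False
    then have "sub_le C n (h i)"
      using n(2) i by blast
    then obtain t where t: "t \<in> Hom C N (Dom C (h i))" "n = h i \<cdot> t"
      by (auto simp: sub_le_def N_def)
    have hi: "h i \<in> Hom C (Dom C (h i)) G"
      using insert.prems i by (auto simp: is_subobject_def is_mono_def Hom_def)
    show ?thesis
      using Comp_assoc[OF qH t(1) hi] Comp_in_Hom[OF qH t(1)] t(2) mD unfolding sub_le_def by metis
  qed
  moreover have "\<exists>s \<in> Hom C T (Dom C (n \<cdot> q)). k = n \<cdot> q \<cdot> s"
    if k: "k \<in> Hom C T G" and fac: "\<forall>i \<in> insert x F. \<exists>s \<in> Hom C T (Dom C (h i)). k = h i \<cdot> s" for T k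
  proof -
    \<comment> \<open>The factorization through \<open>h x\<close> and, by induction, the one
      through \<open>n\<close> form a compatible pair for the pullback.\<close>
    obtain u where u: "u \<in> Hom C T A" "k = h x \<cdot> u"
      using fac by (auto simp: A_def)
    obtain v where v: "v \<in> Hom C T N" "k = n \<cdot> v"
      using univ[OF k] fac by (auto simp: N_def)
    obtain t where t: "t \<in> Hom C T P" "q \<cdot> t = v"
      using pbu[OF u(1) v(1)] u(2) v(2) by auto
    then show ?thesis
      using v(2) mD Comp_assoc[OF t(1) qH nH] by metis
  qed
  ultimately show ?case
    by blast
qed

section \<open>The monad of internal actions\<close>

text \<open>The setting in which the action monad is built: zero arrows, kernels as pullbacks, and
  free points as coproducts.\<close>

locale pointed_limits_coproducts = category C for C :: "('o, 'a) cat" (structure) +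
  assumes pointed: "is_pointed C" and finite_limits: "has_finite_limits C"
    and coproducts: "has_binary_coproducts C"
begin

section \<open>Zero objects and zero arrows\<close>

lemma zero_objectD:
  assumes "is_zero_object C Z" and "A \<in> Obj C"
  shows into_zero: "\<exists>!f. f \<in> Hom C A Z" and from_zero: "\<exists>!f. f \<in> Hom C Z A"
  using assms by (auto simp only: is_zero_object_def)

text \<open>\<open>zero_arrow\<close> is a definite description ranging over all zero objects, so
  independence of the choice has to be shown: the arrow \<open>w\<close> between two zero objects
  carries one factorization to the other.\<close>

lemma zero_arrow_eq:
  assumes Z: "is_zero_object C Z" and u: "u \<in> Hom C A Z" and v: "v \<in> Hom C Z B"
  shows "zero_arrow C A B = v \<cdot> u"
  unfolding zero_arrow_def
proof (rule the_equality)
  show "\<exists>Z u' v'. is_zero_object C Z \<and> u' \<in> Hom C A Z \<and> v' \<in> Hom C Z B \<and> v \<cdot> u = v' \<cdot> u'"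
    using assms by blast
next
  fix f assume "\<exists>Z u v. is_zero_object C Z \<and> u \<in> Hom C A Z \<and> v \<in> Hom C Z B \<and> f = v \<cdot> u"
  then obtain Z' u' v' where Z': "is_zero_object C Z'" and u': "u' \<in> Hom C A Z'"
    and v': "v' \<in> Hom C Z' B" and f: "f = v' \<cdot> u'"
    by blast
  obtain w where w: "w \<in> Hom C Z Z'"
    using into_zero[OF Z'] Hom_Obj[OF v] by blast
  have "w \<cdot> u = u'"
    using into_zero[OF Z'] Hom_Obj[OF u] Comp_in_Hom[OF u w] u' by blast
  moreover have "v' \<cdot> w = v"
    using from_zero[OF Z] Hom_Obj[OF v] Comp_in_Hom[OF w v'] v by blast
  ultimately show "f = v \<cdot> u"
    using f Comp_assoc[OF u w v'] by simp
qed

lemma zero_arrow_factor: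
  assumes "A \<in> Obj C" "B \<in> Obj C"
  obtains Z u v where "is_zero_object C Z" "u \<in> Hom C A Z" "v \<in> Hom C Z B" "zero_arrow C A B = v \<cdot> u"
proof -
  obtain Z where Z: "is_zero_object C Z"
    using pointed unfolding is_pointed_def by blast
  with assms obtain u v where "u \<in> Hom C A Z" "v \<in> Hom C Z B"
    using into_zero from_zero by blast
  with Z zero_arrow_eq that show ?thesis
    by blast
qed

lemma zero_arrow_in_Hom: "A \<in> Obj C \<Longrightarrow> B \<in> Obj C \<Longrightarrow> zero_arrow C A B \<in> Hom C A B"
  by (metis zero_arrow_factor Comp_in_Hom)

lemma zero_arrow_Comp:
  assumes f: "f \<in> Hom C A B" and D: "D \<in> Obj C"
  shows "zero_arrow C B D \<cdot> f = zero_arrow C A D"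
proof -
  obtain Z u v where z: "is_zero_object C Z" "u \<in> Hom C B Z" "v \<in> Hom C Z D"
    "zero_arrow C B D = v \<cdot> u"
    using zero_arrow_factor[of B D] D Hom_Obj[OF f] by blast
  then show ?thesis
    using zero_arrow_eq[OF z(1) Comp_in_Hom[OF f z(2)] z(3)] Comp_assoc[OF f z(2,3)] by simp
qed

section \<open>Kernels and the kernel functor on points\<close>

lemma kernel_ker:
  assumes p: "p \<in> Hom C A B"
  shows "is_kernel C p (ker C p)"
proof -
  obtain Z where Z: "is_zero_object C Z"
    using pointed unfolding is_pointed_def by blast
  obtain z where z: "z \<in> Hom C Z B"
    using from_zero[OF Z] Hom_Obj[OF p] by blast
  \<comment> \<open>The kernel is the pullback along \<open>p\<close> of the arrow from a zero
    object to \<open>B\<close>.\<close>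
  obtain k r where pb: "is_pullback C p z k r"
    using pullback_exists[OF finite_limits p z] by blast
  have k: "k \<in> Hom C (Dom C k) A" and r: "r \<in> Hom C (Dom C k) Z" and sq: "p \<cdot> k = z \<cdot> r"
    using pb p z by (auto simp: is_pullback_def Hom_def)
  have "\<exists>!t. t \<in> Hom C T (Dom C k) \<and> k \<cdot> t = u"
    if T: "T \<in> Obj C" and u: "u \<in> Hom C T A" and pu: "p \<cdot> u = zero_arrow C T B" for T u
  proof -
    obtain v where v: "v \<in> Hom C T Z"
      using into_zero[OF Z T] by blast
    have "p \<cdot> u = z \<cdot> v"
      using pu zero_arrow_eq[OF Z v z] by simp
    then have "\<exists>!t. t \<in> Hom C T (Dom C k) \<and> k \<cdot> t = u \<and> r \<cdot> t = v"
      using pullback_factor[OF pb] u v Hom_Dom_Cod[OF p] Hom_Dom_Cod[OF z] by simp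
    \<comment> \<open>The condition on the second leg is automatic, since arrows into
      \<open>Z\<close> are unique.\<close>
    moreover have "r \<cdot> t = v" if "t \<in> Hom C T (Dom C k)" for t
      using Comp_in_Hom[OF that r] v into_zero[OF Z T] by blast
    ultimately show ?thesis
      by blast
  qed
  then have "is_kernel C p k"
    using Hom_Dom_Cod[OF p] Hom_Dom_Cod[OF k] sq zero_arrow_eq[OF Z r z]
    by (simp add: is_kernel_def)
  then show ?thesis
    unfolding ker_def by (rule someI)
qed

lemma ker_in_Hom: "p \<in> Hom C A B \<Longrightarrow> ker C p \<in> Hom C (Dom C (ker C p)) A"
  using kernel_ker unfolding is_kernel_def Hom_def by force

lemma Comp_ker: "p \<in> Hom C A B \<Longrightarrow> p \<cdot> ker C p = zero_arrow C (Dom C (ker C p)) B"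
  using kernel_ker unfolding is_kernel_def Hom_def by force

lemma ker_factor:
  assumes p: "p \<in> Hom C A B" and u: "u \<in> Hom C T A" "p \<cdot> u = zero_arrow C T B"
  shows "\<exists>!t. t \<in> Hom C T (Dom C (ker C p)) \<and> ker C p \<cdot> t = u"
  using kernel_ker[OF p] Hom_Obj[OF u(1)] Hom_Dom_Cod[OF p] u unfolding is_kernel_def by blast

text \<open>Kernels are monic: \<open>u\<close> and \<open>v\<close> are factorizations of one and
  the same arrow annihilated by \<open>p\<close>.\<close>

lemma ker_cancel:
  assumes p: "p \<in> Hom C A B" and u: "u \<in> Hom C T (Dom C (ker C p))"
    and v: "v \<in> Hom C T (Dom C (ker C p))" and e: "ker C p \<cdot> u = ker C p \<cdot> v"
  shows "u = v"
proof -
  note k = ker_in_Hom[OF p]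
  have "p \<cdot> (ker C p \<cdot> v) = zero_arrow C T B"
    using Comp_assoc[OF v k p] Comp_ker[OF p] zero_arrow_Comp[OF v] Hom_Obj[OF p] by simp
  then show ?thesis
    using ker_factor[OF p Comp_in_Hom[OF v k]] u v e by blast
qed

text \<open>As \<open>f\<close> lies over \<open>B\<close>, the composite
  \<open>f \<cdot> ker C p\<close> is annihilated by \<open>p'\<close> and factors uniquely through
  its kernel, so the description in \<open>Ker_map\<close> is proper.\<close>

lemma Ker_map:
  assumes p: "p \<in> Hom C A B" and p': "p' \<in> Hom C A' B"
    and f: "f \<in> Hom C A A'" and e: "p' \<cdot> f = p"
  shows "Ker_map C (A, p, s) (A', p', s') f \<in> Hom C (Dom C (ker C p)) (Dom C (ker C p'))"
    and "ker C p' \<cdot> Ker_map C (A, p, s) (A', p', s') f = f \<cdot> ker C p"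
proof -
  note k = ker_in_Hom[OF p]
  have "p' \<cdot> (f \<cdot> ker C p) = zero_arrow C (Dom C (ker C p)) B"
    using Comp_assoc[OF k f p'] e Comp_ker[OF p] by simp
  from theI'[OF ker_factor[OF p' Comp_in_Hom[OF k f] this]]
  show "Ker_map C (A, p, s) (A', p', s') f \<in> Hom C (Dom C (ker C p)) (Dom C (ker C p'))"
    and "ker C p' \<cdot> Ker_map C (A, p, s) (A', p', s') f = f \<cdot> ker C p"
    by (simp_all add: Ker_map_def Ker_obj_def)
qed

section \<open>Binary coproducts and copairing\<close>

lemma is_coproduct_inl_inr:
  assumes "A \<in> Obj C" "B \<in> Obj C"
  shows "is_coproduct C A B (inl C A B) (inr C A B)"
proof -
  have "\<exists>x. (case x of (i, j) \<Rightarrow> is_coproduct C A B i j)"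
    using coproducts assms unfolding has_binary_coproducts_def by force
  from someI_ex[OF this] show ?thesis
    by (simp add: inl_def inr_def coprod_inj_def split: prod.splits)
qed

lemma inl_in_Hom: "A \<in> Obj C \<Longrightarrow> B \<in> Obj C \<Longrightarrow> inl C A B \<in> Hom C A (coprod C A B)"
  and inr_in_Hom: "A \<in> Obj C \<Longrightarrow> B \<in> Obj C \<Longrightarrow> inr C A B \<in> Hom C B (coprod C A B)"
  using is_coproduct_inl_inr by (auto simp: is_coproduct_def coprod_def)

lemma coprod_factor:
  assumes f: "f \<in> Hom C A T" and g: "g \<in> Hom C B T"
  shows "\<exists>!t. t \<in> Hom C (coprod C A B) T \<and> t \<cdot> inl C A B = f \<and> t \<cdot> inr C A B = g"
  using is_coproduct_inl_inr Hom_Obj[OF f] Hom_Obj[OF g] f g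
  unfolding is_coproduct_def coprod_def by blast

lemma copair:
  assumes f: "f \<in> Hom C A T" and g: "g \<in> Hom C B T"
  shows copair_in_Hom: "copair C f g \<in> Hom C (coprod C A B) T"
    and copair_inl: "copair C f g \<cdot> inl C A B = f"
    and copair_inr: "copair C f g \<cdot> inr C A B = g"
  using theI'[OF coprod_factor[OF f g]] Hom_Dom_Cod[OF f] Hom_Dom_Cod[OF g]
  by (simp_all add: copair_def)

lemma coprod_ext:
  assumes A: "A \<in> Obj C" and B: "B \<in> Obj C"
    and s: "s \<in> Hom C (coprod C A B) T" and t: "t \<in> Hom C (coprod C A B) T"
    and "s \<cdot> inl C A B = t \<cdot> inl C A B" "s \<cdot> inr C A B = t \<cdot> inr C A B"
  shows "s = t"
  using coprod_factor[OF Comp_in_Hom[OF inl_in_Hom[OF A B] t] Comp_in_Hom[OF inr_in_Hom[OF A B] t]]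
    assms by blast

lemma Comp_copair:
  assumes f: "f \<in> Hom C A T" and g: "g \<in> Hom C B T" and w: "w \<in> Hom C T S"
  shows "w \<cdot> copair C f g = copair C (w \<cdot> f) (w \<cdot> g)"
proof -
  have A: "A \<in> Obj C" and B: "B \<in> Obj C"
    using Hom_Obj[OF f] Hom_Obj[OF g] by auto
  note c = copair_in_Hom[OF f g]
  note wf = Comp_in_Hom[OF f w] and wg = Comp_in_Hom[OF g w]
  show ?thesis
    using Comp_assoc[OF inl_in_Hom[OF A B] c w] Comp_assoc[OF inr_in_Hom[OF A B] c w]
    by (intro coprod_ext[OF A B Comp_in_Hom[OF c w] copair_in_Hom[OF wf wg]])
      (simp_all add: copair_inl[OF f g] copair_inr[OF f g] copair_inl[OF wf wg] copair_inr[OF wf wg])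
qed

section \<open>Free points and the functor \<open>flat\<close>\<close>

definition free_proj :: "'o \<Rightarrow> 'o \<Rightarrow> 'a" where
  "free_proj B X = copair C (Id C B) (zero_arrow C X B)"

text \<open>The canonical inclusion of \<open>flat C B X\<close> into
  \<open>coprod C B X\<close>.\<close>

definition flat_incl :: "'o \<Rightarrow> 'o \<Rightarrow> 'a" where
  "flat_incl B X = ker C (free_proj B X)"

lemma free_proj:
  assumes "B \<in> Obj C" "X \<in> Obj C"
  shows free_proj_in_Hom: "free_proj B X \<in> Hom C (coprod C B X) B"
    and free_proj_inl: "free_proj B X \<cdot> inl C B X = Id C B"
    and free_proj_inr: "free_proj B X \<cdot> inr C B X = zero_arrow C X B"
  using copair[OF Id_in_Hom[OF assms(1)] zero_arrow_in_Hom[OF assms(2,1)]]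
  by (simp_all add: free_proj_def)

lemma flat_eq: "flat C B X = Dom C (flat_incl B X)"
  by (simp add: flat_def Ker_obj_def free_point_def flat_incl_def free_proj_def)

lemma flat_incl_in_Hom:
  assumes "B \<in> Obj C" "X \<in> Obj C"
  shows "flat_incl B X \<in> Hom C (flat C B X) (coprod C B X)"
  using ker_in_Hom[OF free_proj_in_Hom[OF assms]] by (simp add: flat_eq flat_incl_def)

text \<open>Since the inclusion is a kernel, equations between arrows into \<open>flat C B X\<close>
  may be checked in the coproduct. Functoriality and both naturality laws below are proved this
  way.\<close>

lemma flat_incl_cancel:
  assumes "B \<in> Obj C" "X \<in> Obj C" "u \<in> Hom C T (flat C B X)" "v \<in> Hom C T (flat C B X)"
    "flat_incl B X \<cdot> u = flat_incl B X \<cdot> v"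
  shows "u = v"
  using ker_cancel[OF free_proj_in_Hom[OF assms(1,2)]] assms(3-5)
  by (simp add: flat_eq flat_incl_def)

lemma flat_in_Obj: "B \<in> Obj C \<Longrightarrow> X \<in> Obj C \<Longrightarrow> flat C B X \<in> Obj C"
  using flat_incl_in_Hom Hom_Obj by blast

text \<open>The equations with \<open>inl\<close> and \<open>free_proj\<close> make
  \<open>free_point_map C B f\<close> a morphism of free points; the latter is the hypothesis that
  \<open>Ker_map\<close> asks for.\<close>

lemma free_point_map:
  assumes B: "B \<in> Obj C" and f: "f \<in> Hom C X Y"
  shows free_point_map_in_Hom: "free_point_map C B f \<in> Hom C (coprod C B X) (coprod C B Y)"
    and free_point_map_inl: "free_point_map C B f \<cdot> inl C B X = inl C B Y"
    and free_point_map_inr: "free_point_map C B f \<cdot> inr C B X = inr C B Y \<cdot> f"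
    and free_proj_free_point_map: "free_proj B Y \<cdot> free_point_map C B f = free_proj B X"
proof -
  have X: "X \<in> Obj C" and Y: "Y \<in> Obj C" and cod: "Cod C f = Y"
    using Hom_Obj[OF f] Hom_Dom_Cod[OF f] by auto
  note l = inl_in_Hom[OF B Y] and r = Comp_in_Hom[OF f inr_in_Hom[OF B Y]]
    and pr = free_proj_in_Hom[OF B Y]
  show "free_point_map C B f \<in> Hom C (coprod C B X) (coprod C B Y)"
    "free_point_map C B f \<cdot> inl C B X = inl C B Y"
    "free_point_map C B f \<cdot> inr C B X = inr C B Y \<cdot> f"
    using copair[OF l r] by (simp_all add: free_point_map_def cod)
  show "free_proj B Y \<cdot> free_point_map C B f = free_proj B X"
    using Comp_copair[OF l r pr] Comp_assoc[OF f inr_in_Hom[OF B Y] pr]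
    by (simp add: free_point_map_def cod free_proj_inl[OF B Y] free_proj_inr[OF B Y]
        zero_arrow_Comp[OF f B] free_proj_def[of B X])
qed

text \<open>A fusion law, serving both functoriality of \<open>free_point_map\<close> and naturality
  of the counit.\<close>

lemma copair_inl_Comp_free_point_map:
  assumes B: "B \<in> Obj C" and f: "f \<in> Hom C X Y" and l: "l \<in> Hom C B T" and g: "g \<in> Hom C Y T"
  shows "copair C l g \<cdot> free_point_map C B f = copair C l (g \<cdot> f)"
proof -
  have X: "X \<in> Obj C" and Y: "Y \<in> Obj C" and cod: "Cod C f = Y"
    using Hom_Obj[OF f] Hom_Dom_Cod[OF f] by auto
  show ?thesis
    using Comp_copair[OF inl_in_Hom[OF B Y] Comp_in_Hom[OF f inr_in_Hom[OF B Y]]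
        copair_in_Hom[OF l g]] Comp_assoc[OF f inr_in_Hom[OF B Y] copair_in_Hom[OF l g]]
    by (simp add: free_point_map_def cod copair_inl[OF l g] copair_inr[OF l g])
qed

lemma free_point_map_Comp:
  assumes B: "B \<in> Obj C" and f: "f \<in> Hom C X Y" and g: "g \<in> Hom C Y W"
  shows "free_point_map C B (g \<cdot> f) = free_point_map C B g \<cdot> free_point_map C B f"
proof -
  have W: "W \<in> Obj C"
    using Hom_Obj[OF g] by blast
  note r = inr_in_Hom[OF B W]
  show ?thesis
    using copair_inl_Comp_free_point_map[OF B f inl_in_Hom[OF B W] Comp_in_Hom[OF g r]]
      Comp_assoc[OF f g r] Hom_Dom_Cod[OF g] Hom_Dom_Cod[OF Comp_in_Hom[OF f g]]
    by (simp add: free_point_map_def[of C B g] free_point_map_def[of C B "g \<cdot> f"])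
qed

lemma flat_map:
  assumes B: "B \<in> Obj C" and f: "f \<in> Hom C X Y"
  shows flat_map_in_Hom: "flat_map C B f \<in> Hom C (flat C B X) (flat C B Y)"
    and flat_incl_flat_map:
      "flat_incl B Y \<cdot> flat_map C B f = free_point_map C B f \<cdot> flat_incl B X"
proof -
  have X: "X \<in> Obj C" and Y: "Y \<in> Obj C"
    using Hom_Obj[OF f] by auto
  show "flat_map C B f \<in> Hom C (flat C B X) (flat C B Y)"
    and "flat_incl B Y \<cdot> flat_map C B f = free_point_map C B f \<cdot> flat_incl B X"
    using Ker_map[OF free_proj_in_Hom[OF B X] free_proj_in_Hom[OF B Y]
        free_point_map_in_Hom[OF B f] free_proj_free_point_map[OF B f]] Hom_Dom_Cod[OF f]
    by (simp_all add: flat_map_def free_point_def flat_eq flat_incl_def free_proj_def)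
qed

lemma flat_map_Comp:
  assumes B: "B \<in> Obj C" and f: "f \<in> Hom C X Y" and g: "g \<in> Hom C Y W"
  shows "flat_map C B (g \<cdot> f) = flat_map C B g \<cdot> flat_map C B f"
proof -
  have X: "X \<in> Obj C" and Y: "Y \<in> Obj C" and W: "W \<in> Obj C"
    using Hom_Obj[OF f] Hom_Obj[OF g] by auto
  note gf = Comp_in_Hom[OF f g] and F = flat_map_in_Hom[OF B f] and G = flat_map_in_Hom[OF B g]
  have "flat_incl B W \<cdot> flat_map C B (g \<cdot> f) =
      free_point_map C B g \<cdot> (free_point_map C B f \<cdot> flat_incl B X)"
    using Comp_assoc[OF flat_incl_in_Hom[OF B X] free_point_map_in_Hom[OF B f]
        free_point_map_in_Hom[OF B g]]
    by (simp add: flat_incl_flat_map[OF B gf] free_point_map_Comp[OF B f g])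
  also have "\<dots> = free_point_map C B g \<cdot> (flat_incl B Y \<cdot> flat_map C B f)"
    by (simp add: flat_incl_flat_map[OF B f])
  also have "\<dots> = flat_incl B W \<cdot> (flat_map C B g \<cdot> flat_map C B f)"
    using Comp_assoc[OF F flat_incl_in_Hom[OF B Y] free_point_map_in_Hom[OF B g]]
      Comp_assoc[OF F G flat_incl_in_Hom[OF B W]]
    by (simp add: flat_incl_flat_map[OF B g])
  finally show ?thesis
    by (rule flat_incl_cancel[OF B W flat_map_in_Hom[OF B gf] Comp_in_Hom[OF F G]])
qed

section \<open>Unit and multiplication of the monad\<close>

lemma flat_unit:
  assumes B: "B \<in> Obj C" and X: "X \<in> Obj C"
  shows flat_unit_in_Hom: "flat_unit C B X \<in> Hom C X (flat C B X)"
    and flat_incl_flat_unit: "flat_incl B X \<cdot> flat_unit C B X = inr C B X"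
  using theI'[OF ker_factor[OF free_proj_in_Hom[OF B X] inr_in_Hom[OF B X] free_proj_inr[OF B X]]]
  by (simp_all add: flat_unit_def flat_eq flat_incl_def free_proj_def)

lemma flat_unit_natural:
  assumes B: "B \<in> Obj C" and f: "f \<in> Hom C X Y"
  shows "flat_map C B f \<cdot> flat_unit C B X = flat_unit C B Y \<cdot> f"
proof -
  have X: "X \<in> Obj C" and Y: "Y \<in> Obj C"
    using Hom_Obj[OF f] by auto
  note uX = flat_unit_in_Hom[OF B X] and uY = flat_unit_in_Hom[OF B Y]
    and F = flat_map_in_Hom[OF B f] and iY = flat_incl_in_Hom[OF B Y]
  have "flat_incl B Y \<cdot> (flat_map C B f \<cdot> flat_unit C B X)
      = free_point_map C B f \<cdot> inr C B X"
    using Comp_assoc[OF uX F iY]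
      Comp_assoc[OF uX flat_incl_in_Hom[OF B X] free_point_map_in_Hom[OF B f]]
    by (simp add: flat_incl_flat_map[OF B f] flat_incl_flat_unit[OF B X])
  also have "\<dots> = flat_incl B Y \<cdot> (flat_unit C B Y \<cdot> f)"
    using Comp_assoc[OF f uY iY]
    by (simp add: free_point_map_inr[OF B f] flat_incl_flat_unit[OF B Y])
  finally show ?thesis
    by (rule flat_incl_cancel[OF B Y Comp_in_Hom[OF uX F] Comp_in_Hom[OF f uY]])
qed

text \<open>The counit at the free point on \<open>X\<close> is the copairing of
  \<open>inl C B X\<close> with \<open>flat_incl B X\<close>; the multiplication is its restriction
  to kernels.\<close>

lemma flat_mult:
  assumes B: "B \<in> Obj C" and X: "X \<in> Obj C"
  shows flat_mult_in_Hom: "flat_mult C B X \<in> Hom C (flat C B (flat C B X)) (flat C B X)"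
    and flat_incl_flat_mult: "flat_incl B X \<cdot> flat_mult C B X =
      copair C (inl C B X) (flat_incl B X) \<cdot> flat_incl B (flat C B X)"
proof -
  note l = inl_in_Hom[OF B X] and i = flat_incl_in_Hom[OF B X] and F = flat_in_Obj[OF B X]
    and pr = free_proj_in_Hom[OF B X]
  \<comment> \<open>The counit lies over \<open>B\<close>: the projection sends \<open>inl\<close>
    to the identity and annihilates its own kernel \<open>flat_incl B X\<close>.\<close>
  have "free_proj B X \<cdot> copair C (inl C B X) (flat_incl B X) = free_proj B (flat C B X)"
    unfolding Comp_copair[OF l i pr] free_proj_inl[OF B X] free_proj_def[of B "flat C B X"]
    using Comp_ker[OF pr] by (simp add: flat_eq flat_incl_def)
  from Ker_map[OF free_proj_in_Hom[OF B F] pr copair_in_Hom[OF l i] this]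
  show "flat_mult C B X \<in> Hom C (flat C B (flat C B X)) (flat C B X)"
    and "flat_incl B X \<cdot> flat_mult C B X =
      copair C (inl C B X) (flat_incl B X) \<cdot> flat_incl B (flat C B X)"
    by (simp_all add: flat_mult_def free_point_def point_counit_def flat_eq flat_incl_def
        free_proj_def)
qed

text \<open>Naturality of the counit, restricted to kernels.\<close>

lemma flat_mult_natural:
  assumes B: "B \<in> Obj C" and f: "f \<in> Hom C X Y"
  shows "flat_map C B f \<cdot> flat_mult C B X = flat_mult C B Y \<cdot> flat_map C B (flat_map C B f)"
proof -
  have X: "X \<in> Obj C" and Y: "Y \<in> Obj C"
    using Hom_Obj[OF f] by auto
  note F = flat_map_in_Hom[OF B f] and FX = flat_in_Obj[OF B X] and FY = flat_in_Obj[OF B Y]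
  note FF = flat_map_in_Hom[OF B F]
    and mX = flat_mult_in_Hom[OF B X] and mY = flat_mult_in_Hom[OF B Y]
    and iX = flat_incl_in_Hom[OF B X] and iY = flat_incl_in_Hom[OF B Y]
    and iFX = flat_incl_in_Hom[OF B FX] and iFY = flat_incl_in_Hom[OF B FY]
    and P = free_point_map_in_Hom[OF B f] and PF = free_point_map_in_Hom[OF B F]
    and lX = inl_in_Hom[OF B X] and lY = inl_in_Hom[OF B Y]
  note cX = copair_in_Hom[OF lX iX] and cY = copair_in_Hom[OF lY iY]
  \<comment> \<open>Both sides are the copairing of \<open>inl C B Y\<close> with
    \<open>flat_incl B Y \<cdot> flat_map C B f\<close>.\<close>
  have counit: "free_point_map C B f \<cdot> copair C (inl C B X) (flat_incl B X)
      = copair C (inl C B Y) (flat_incl B Y) \<cdot> free_point_map C B (flat_map C B f)"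
    by (simp add: Comp_copair[OF lX iX P] copair_inl_Comp_free_point_map[OF B F lY iY]
        free_point_map_inl[OF B f] flat_incl_flat_map[OF B f])
  have "flat_incl B Y \<cdot> (flat_map C B f \<cdot> flat_mult C B X)
      = free_point_map C B f \<cdot> (flat_incl B X \<cdot> flat_mult C B X)"
    using Comp_assoc[OF mX F iY] Comp_assoc[OF mX iX P] by (simp add: flat_incl_flat_map[OF B f])
  also have "\<dots> = copair C (inl C B Y) (flat_incl B Y) \<cdot>
      free_point_map C B (flat_map C B f) \<cdot> flat_incl B (flat C B X)"
    using Comp_assoc[OF iFX cX P] counit by (simp add: flat_incl_flat_mult[OF B X])
  also have "\<dots> = copair C (inl C B Y) (flat_incl B Y) \<cdot>
      (flat_incl B (flat C B Y) \<cdot> flat_map C B (flat_map C B f))"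
    using Comp_assoc[OF iFX PF cY] by (simp add: flat_incl_flat_map[OF B F])
  also have "\<dots> = flat_incl B Y \<cdot> (flat_mult C B Y \<cdot> flat_map C B (flat_map C B f))"
    using Comp_assoc[OF FF iFY cY] Comp_assoc[OF FF mY iY]
    by (simp add: flat_incl_flat_mult[OF B Y])
  finally show ?thesis
    by (rule flat_incl_cancel[OF B Y Comp_in_Hom[OF mX F] Comp_in_Hom[OF FF mY]])
qed

section \<open>Restriction of actions\<close>

text \<open>After composition with \<open>m\<close>, the unit law reduces to that of
  \<open>\<xi>\<close> by naturality of the unit, and the multiplication law to that of
  \<open>\<xi>\<close> by naturality of the multiplication and functoriality; \<open>m\<close> is
  then cancelled.\<close>

lemma restricted_action:
  assumes B: "B \<in> Obj C" and act: "is_action C B G \<xi>" and mono: "is_mono C m"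
    and m: "m \<in> Hom C M G" and \<zeta>: "\<zeta> \<in> Hom C (flat C B M) M"
    and eq: "m \<cdot> \<zeta> = \<xi> \<cdot> flat_map C B m"
  shows "is_action C B M \<zeta>"
proof -
  have M: "M \<in> Obj C" and G: "G \<in> Obj C"
    using Hom_Obj[OF m] by auto
  have \<xi>: "\<xi> \<in> Hom C (flat C B G) G" and unit: "\<xi> \<cdot> flat_unit C B G = Id C G"
    and mult: "\<xi> \<cdot> flat_mult C B G = \<xi> \<cdot> flat_map C B \<xi>"
    using act by (auto simp: is_action_def)
  have cancel: "u = v" if "u \<in> Hom C T M" "v \<in> Hom C T M" "m \<cdot> u = m \<cdot> v" for T u v
    using mono that Hom_Obj[OF that(1)] Hom_Dom_Cod[OF m] unfolding is_mono_def by blast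
  note F = flat_map_in_Hom[OF B m] and F\<zeta> = flat_map_in_Hom[OF B \<zeta>]
    and F\<xi> = flat_map_in_Hom[OF B \<xi>]
    and uM = flat_unit_in_Hom[OF B M] and uG = flat_unit_in_Hom[OF B G]
    and mM = flat_mult_in_Hom[OF B M] and mG = flat_mult_in_Hom[OF B G]
  note FF = flat_map_in_Hom[OF B F]
  have "m \<cdot> (\<zeta> \<cdot> flat_unit C B M) = \<xi> \<cdot> (flat_map C B m \<cdot> flat_unit C B M)"
    using Comp_assoc[OF uM \<zeta> m] Comp_assoc[OF uM F \<xi>] eq by simp
  also have "\<dots> = m \<cdot> Id C M"
    using Comp_assoc[OF m uG \<xi>] unit
    by (simp add: flat_unit_natural[OF B m] Id_Comp[OF m] Comp_Id[OF m])
  finally have 1: "\<zeta> \<cdot> flat_unit C B M = Id C M"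
    by (rule cancel[OF Comp_in_Hom[OF uM \<zeta>] Id_in_Hom[OF M]])
  have "m \<cdot> (\<zeta> \<cdot> flat_mult C B M) = \<xi> \<cdot> (flat_map C B m \<cdot> flat_mult C B M)"
    using Comp_assoc[OF mM \<zeta> m] Comp_assoc[OF mM F \<xi>] eq by simp
  also have "\<dots> = \<xi> \<cdot> flat_map C B \<xi> \<cdot> flat_map C B (flat_map C B m)"
    using Comp_assoc[OF FF mG \<xi>] mult by (simp add: flat_mult_natural[OF B m])
  \<comment> \<open>Here \<open>eq\<close> is applied inside the functor; the next step applies it
    once more outside.\<close>
  also have "\<dots> = \<xi> \<cdot> flat_map C B (m \<cdot> \<zeta>)"
    using Comp_assoc[OF FF F\<xi> \<xi>] by (simp add: flat_map_Comp[OF B F \<xi>] eq)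
  also have "\<dots> = m \<cdot> (\<zeta> \<cdot> flat_map C B \<zeta>)"
    unfolding flat_map_Comp[OF B \<zeta> m]
    using Comp_assoc[OF F\<zeta> F \<xi>] Comp_assoc[OF F\<zeta> \<zeta> m] eq by simp
  finally have "\<zeta> \<cdot> flat_mult C B M = \<zeta> \<cdot> flat_map C B \<zeta>"
    by (rule cancel[OF Comp_in_Hom[OF mM \<zeta>] Comp_in_Hom[OF F\<zeta> \<zeta>]])
  with 1 \<zeta> show ?thesis
    by (simp add: is_action_def)
qed

text \<open>A bare factorization suffices: \<open>restricted_action\<close> turns it into an action,
  and uniqueness follows from \<open>m\<close> being monic.\<close>

lemma characteristicI:
  assumes sub: "is_subobject C G m"
    and fac: "\<And>B \<xi>. B \<in> Obj C \<Longrightarrow> is_action C B G \<xi> \<Longrightarrow>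
      \<exists>\<zeta> \<in> Hom C (flat C B (Dom C m)) (Dom C m). m \<cdot> \<zeta> = \<xi> \<cdot> flat_map C B m"
  shows "characteristic C G m"
  unfolding characteristic_def
proof (intro conjI ballI allI impI sub)
  fix B \<xi> assume B: "B \<in> Obj C" and act: "is_action C B G \<xi>"
  have mono: "is_mono C m" and m: "m \<in> Hom C (Dom C m) G"
    using sub by (auto simp: is_subobject_def is_mono_def Hom_def)
  obtain \<zeta> where \<zeta>: "\<zeta> \<in> Hom C (flat C B (Dom C m)) (Dom C m)"
    and eq: "m \<cdot> \<zeta> = \<xi> \<cdot> flat_map C B m"
    using fac[OF B act] by blast
  show "\<exists>!\<zeta>. is_action C B (Dom C m) \<zeta> \<and> m \<cdot> \<zeta> = \<xi> \<cdot> flat_map C B m"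
  proof (rule ex1I[of _ \<zeta>])
    show "is_action C B (Dom C m) \<zeta> \<and> m \<cdot> \<zeta> = \<xi> \<cdot> flat_map C B m"
      using restricted_action[OF B act mono m \<zeta> eq] eq by blast
  next
    fix \<zeta>' assume "is_action C B (Dom C m) \<zeta>' \<and> m \<cdot> \<zeta>' = \<xi> \<cdot> flat_map C B m"
    then show "\<zeta>' = \<zeta>"
      using mono \<zeta> eq Hom_Obj[OF \<zeta>] unfolding is_mono_def is_action_def by metis
  qed
qed

lemma characteristic_intersection:
  assumes G: "G \<in> Obj C" and fin: "finite I"
    and char: "\<And>i. i \<in> I \<Longrightarrow> characteristic C G (h i)"
    and int: "is_intersection C G I h m"
  shows "characteristic C G m"
proof (rule characteristicI)
  show sub: "is_subobject C G m"
    using int by (simp add: is_intersection_def)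
  then have m: "m \<in> Hom C (Dom C m) G"
    by (auto simp: is_subobject_def is_mono_def Hom_def)
  have hsub: "\<forall>i \<in> I. is_subobject C G (h i)"
    using char by (simp add: characteristic_def)
  obtain n where n: "is_subobject C G n" "\<forall>i \<in> I. sub_le C n (h i)"
    and univ: "\<forall>T. \<forall>k \<in> Hom C T G. (\<forall>i \<in> I. \<exists>s \<in> Hom C T (Dom C (h i)). k = h i \<cdot> s) \<longrightarrow>
       (\<exists>s \<in> Hom C T (Dom C n). k = n \<cdot> s)"
    using finite_meet_arrow[OF finite_limits G fin hsub] by blast
  \<comment> \<open>The meet property of \<open>m\<close> speaks only of subobjects, but
    \<open>n\<close> is one lying below every \<open>h i\<close>. Hence \<open>n\<close> factors
    through \<open>m\<close> by \<open>t\<close>, and every arrow factoring through \<open>n\<close>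
    factors through \<open>m\<close>.\<close>
  obtain t where t: "t \<in> Hom C (Dom C n) (Dom C m)" "n = m \<cdot> t"
    using int n unfolding is_intersection_def sub_le_def by blast
  fix B \<xi> assume B: "B \<in> Obj C" and act: "is_action C B G \<xi>"
  have \<xi>: "\<xi> \<in> Hom C (flat C B G) G"
    using act by (simp add: is_action_def)
  let ?k = "\<xi> \<cdot> flat_map C B m"
  have "\<exists>s \<in> Hom C (flat C B (Dom C m)) (Dom C (h i)). ?k = h i \<cdot> s" if i: "i \<in> I" for i
  proof -
    have hi: "h i \<in> Hom C (Dom C (h i)) G"
      using hsub i by (auto simp: is_subobject_def is_mono_def Hom_def)
    obtain u where u: "u \<in> Hom C (Dom C m) (Dom C (h i))" "m = h i \<cdot> u"
      using int i unfolding is_intersection_def sub_le_def by blast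
    obtain \<xi>' where "is_action C B (Dom C (h i)) \<xi>'" and e: "h i \<cdot> \<xi>' = \<xi> \<cdot> flat_map C B (h i)"
      using char[OF i] B act unfolding characteristic_def by blast
    then have \<xi>': "\<xi>' \<in> Hom C (flat C B (Dom C (h i))) (Dom C (h i))"
      by (simp add: is_action_def)
    note U = flat_map_in_Hom[OF B u(1)]
    \<comment> \<open>Writing \<open>m\<close> as \<open>h i \<cdot> u\<close> splits
      \<open>flat_map C B m\<close> by functoriality, after which the restricted action
      \<open>\<xi>'\<close> moves \<open>h i\<close> to the front.\<close>
    have "?k = h i \<cdot> (\<xi>' \<cdot> flat_map C B u)"
      using flat_map_Comp[OF B u(1) hi] Comp_assoc[OF U flat_map_in_Hom[OF B hi] \<xi>]
        Comp_assoc[OF U \<xi>' hi] e u(2) by simp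
    then show ?thesis
      using Comp_in_Hom[OF U \<xi>'] by blast
  qed
  then obtain s where s: "s \<in> Hom C (flat C B (Dom C m)) (Dom C n)" "?k = n \<cdot> s"
    using univ Comp_in_Hom[OF flat_map_in_Hom[OF B m] \<xi>] by blast
  then show "\<exists>\<zeta> \<in> Hom C (flat C B (Dom C m)) (Dom C m). m \<cdot> \<zeta> = ?k"
    using Comp_assoc[OF s(1) t(1) m] Comp_in_Hom[OF s(1) t(1)] t(2) by auto
qed

end

theorem proposition2p6:
  fixes C :: "('o, 'a) cat" and G :: 'o and I :: "'i set" and h :: "'i \<Rightarrow> 'a" and m :: 'a
  assumes "semi_abelian C"
    and "G \<in> Obj C"
    and "finite I"
    and "\<And>i. i \<in> I \<Longrightarrow> characteristic C G (h i)"
    and "is_intersection C G I h m"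
  shows "characteristic C G m"
proof -
  \<comment> \<open>Finite limits are read off from \<open>is_protomodular\<close>, which includes
    them.\<close>
  interpret pointed_limits_coproducts C
    using assms(1)
    by (auto simp: pointed_limits_coproducts_def pointed_limits_coproducts_axioms_def
        semi_abelian_def is_protomodular_def)
  show ?thesis
    using characteristic_intersection assms(2-5) by blast
qed

end
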